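(* Let $u,v,r$ be integers with $v > u \geq 0$ and $r \geq 0$, let $K \geq 1$ be an integer and $x \geq 1$ real. There exist rational numbers $c^+_\ell$ ($1\le \ell\le K$) such that for every positive integer $n \leq x$, \[ \tau_{ r + \frac uv }(n) = \sum_{\ell = 1}^K c^+_\ell \mathop{\sum \cdots \sum}_{ \substack{ m_1 \cdots m_{\ell + r}\, n_1 \cdots n_{\ell v - u} = n \\ n_1, \ldots, n_{\ell v - u} \leq x^{1/K} } } \tau_{-\frac1v}( n_1 ) \cdots \tau_{-\frac1v}( n_{\ell v - u} ), \] and, if $r \geq 1$, there exist rational numbers $c^-_\ell$ ($1\le\ell\le K$) such that for every positive integer $n\le x$, \[ \tau_{ -r + \frac uv }(n) = \sum_{\ell = 1}^K c^-_\ell \mathop{\sum \cdots \sum}_{ \substack{ m_1 \cdots m_{\ell - 1}\, n_1 \cdots n_{\ell v + (r - 1)v - u} = n \\ n_1, \ldots, n_{\ell v + (r - 1)v - u} \leq x^{1/K} } } \tau_{-\frac1v}( n_1 ) \cdots \tau_{-\frac1v}( n_{\ell v + (r - 1)v - u} ). \] Here all $m_i, n_i$ range over positive integers. Moreover $|c^+_\ell|, |c^-_\ell| \le C$ for $1 \leq \ell \leq K$, where $C$ depends only on $K$ and $r$.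
   Context: For $z\in\mathbb C$, the generalized divisor function $\tau_z$ is defined by $\sum_{n\ge1}\tau_z(n)n^{-s}=\zeta(s)^z$ for $\Re(s)>1$; it is multiplicative with $\tau_z(p^\ell)=\binom{z+\ell-1}{\ell}$. *)

theory Defs
  imports "HOL-Complex_Analysis.Complex_Analysis"
begin

text \<open>The Riemann zeta function, used only in the half-plane of absolute convergence.\<close>

definition zeta :: "complex \<Rightarrow> complex" where
  "zeta s = (\<Sum>\<^sub>\<infinity>n\<in>{1::nat..}. of_nat n powr (- s))"

text \<open>
  The power $\zeta(s)^z$ refers to the holomorphic branch of the logarithm of $\zeta$ on
  the half-plane $\Re(s) > 1$ that is real for real $s$. It is not the principal
  logarithm of the value $\zeta(s)$, which is discontinuous there. The branch is unique
  on the half-plane; values outside of it are irrelevant.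
\<close>

definition ln_zeta :: "complex \<Rightarrow> complex" where
  "ln_zeta = (SOME L. L holomorphic_on {s. Re s > 1} \<and>
     (\<forall>s. Re s > 1 \<longrightarrow> exp (L s) = zeta s) \<and>
     (\<forall>t::real. t > 1 \<longrightarrow> L (of_real t) \<in> \<real>))"

definition zeta_pow :: "complex \<Rightarrow> complex \<Rightarrow> complex" where
  "zeta_pow z s = exp (z * ln_zeta s)"

text \<open>
  The generalized divisor function $\tau_z$: the coefficients of the Dirichlet series of
  $\zeta(s)^z$. The value at 0, which the series does not determine, is set to 0.
\<close>

definition gen_divisor :: "complex \<Rightarrow> nat \<Rightarrow> complex" where
  "gen_divisor z = (THE f. f 0 = 0 \<and>
     (\<forall>s. Re s > 1 \<longrightarrow> ((\<lambda>n. f n * of_nat n powr (- s)) has_sum zeta_pow z s) {1::nat..}))"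

definition factor_tuples :: "nat \<Rightarrow> nat \<Rightarrow> real \<Rightarrow> nat \<Rightarrow> (nat list \<times> nat list) set" where
  "factor_tuples a b y n = {(ms, ns). length ms = a \<and> length ns = b \<and>
     (\<forall>m\<in>set ms. 0 < m) \<and> (\<forall>k\<in>set ns. 0 < k \<and> real k \<le> y) \<and>
     prod_list ms * prod_list ns = n}"

end

theory Submission
  imports Defs "HOL-Number_Theory.Prime_Powers"
begin

text \<open>
  Arithmetic functions form a commutative ring under Dirichlet convolution, on which
  multiplication by \<open>ln n\<close> is a derivation \<open>D\<close>. In this ring \<open>\<tau>\<^sub>z\<close> is the solution of
  \<open>D \<tau>\<^sub>z = z \<Lambda> \<tau>\<^sub>z\<close> with \<open>\<tau>\<^sub>z(1) = 1\<close>, where \<open>\<Lambda>\<close> is the von Mangoldt function, which gives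
  \<open>\<tau>\<^sub>z\<^sub>+\<^sub>w = \<tau>\<^sub>z \<tau>\<^sub>w\<close> and \<open>\<tau>\<^sub>1 = 1\<close>; the same differential equation for the Dirichlet series
  identifies it with the coefficients of \<open>\<zeta>(s)\<^sup>z\<close>.

  Let \<open>G\<close> be the truncation of \<open>\<tau>\<close> with parameter \<open>-1/v\<close> to \<open>n \<le> y = x\<^bsup>1/K\<^esup>\<close>, and let \<open>Q = \<tau>\<^bsub>1/v\<^esub> G\<close>.
  Then \<open>Q - 1\<close> is supported on \<open>n > y\<close>, so that products of \<open>K\<close> such functions vanish for
  \<open>n \<le> x\<close>. With \<open>P = Q\<^sup>v = \<zeta> G\<^sup>v\<close> and \<open>w = R v - u\<close>, the binomial series of
  \<open>(1 - (1 - P))\<close> to the power \<open>-w/v\<close>, cut off at degree \<open>K\<close>, therefore inverts \<open>Q\<^sup>w\<close> up to \<open>x\<close>.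
  Expanding it in powers of \<open>P\<close> and multiplying by \<open>\<tau>\<^sub>z\<close> gives both identities, with
  \<open>R = 1\<close> for \<open>z = r + u/v\<close> and \<open>R = r\<close> for \<open>z = - r + u/v\<close>.
\<close>

section \<open>The ring of arithmetic functions\<close>

lemma finite_mult_pairs: "n > 0 \<Longrightarrow> finite {(a, b). a * b = (n::nat)}"
  by (rule finite_subset[of _ "{..n} \<times> {..n}"]) auto

lemma infinite_mult_pairs_0: "infinite {(a, b). a * b = (0::nat)}"
proof
  assume "finite {(a, b). a * b = (0::nat)}"
  then have "finite (range (\<lambda>b::nat. (0::nat, b)))"
    by (rule finite_subset[rotated]) auto
  then show False
    by (simp add: finite_image_iff inj_on_def)
qed

text \<open>Pinning the value at 0 lets equality be tested at positive indices alone and makes the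
  unit of convolution act correctly at 0 as well.\<close>

typedef dser = "{f :: nat \<Rightarrow> complex. f 0 = 0}"
  morphisms coeff Abs_dser
  by (rule exI[of _ "\<lambda>_. 0"]) simp

setup_lifting type_definition_dser

lemma coeff_0 [simp]: "coeff f 0 = 0"
  by transfer simp

lemma dser_eqI: "(\<And>n. n > 0 \<Longrightarrow> coeff f n = coeff g n) \<Longrightarrow> f = g"
  by (metis coeff_0 coeff_inject ext neq0_conv)

instantiation dser :: comm_ring_1
begin

lift_definition zero_dser :: dser is "\<lambda>_. 0" by simp
lift_definition one_dser :: dser is "\<lambda>n. if n = 1 then 1 else 0" by simp
lift_definition plus_dser :: "dser \<Rightarrow> dser \<Rightarrow> dser" is "\<lambda>f g n. f n + g n" by simp
lift_definition minus_dser :: "dser \<Rightarrow> dser \<Rightarrow> dser" is "\<lambda>f g n. f n - g n" by simp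
lift_definition uminus_dser :: "dser \<Rightarrow> dser" is "\<lambda>f n. - f n" by simp

text \<open>At \<open>n = 0\<close> the index set is infinite, so that the sum is 0.\<close>

lift_definition times_dser :: "dser \<Rightarrow> dser \<Rightarrow> dser"
  is "\<lambda>f g n. \<Sum>(a, b) | a * b = n. f a * g b"
  using infinite_mult_pairs_0 by simp

instance
proof
  fix f g h :: dser
  show "f * g * h = f * (g * h)"
  proof (rule dser_eqI)
    fix n :: nat assume n: "n > 0"
    have fin: "finite {(a, b). a * b = m}" if "m dvd n" for m
      using that n by (intro finite_mult_pairs) (auto intro: Nat.gr0I)
    have "coeff (f * g * h) n =
        (\<Sum>p | fst p * snd p = n. \<Sum>q | fst q * snd q = fst p.
           coeff f (fst q) * coeff g (snd q) * coeff h (snd p))"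
      by (simp add: times_dser.rep_eq sum_distrib_right case_prod_unfold)
    also have "\<dots> = (\<Sum>(p, q) \<in> Sigma {p. fst p * snd p = n} (\<lambda>p. {q. fst q * snd q = fst p}).
           coeff f (fst q) * coeff g (snd q) * coeff h (snd p))"
      using fin by (subst sum.Sigma) (auto simp: case_prod_unfold)
    \<comment> \<open>Both sums run over the ordered factorisations of \<open>n\<close> into three
      factors, grouped from the left before and from the right after.\<close>
    also have "\<dots> = (\<Sum>(p, q) \<in> Sigma {p. fst p * snd p = n} (\<lambda>p. {q. fst q * snd q = snd p}).
           coeff f (fst p) * (coeff g (fst q) * coeff h (snd q)))"
      by (rule sum.reindex_bij_witness
            [of _ "\<lambda>((a, m), (b, c)). ((a * b, c), (a, b))" "\<lambda>((m, c), (a, b)). ((a, b * c), (b, c))"])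
         (auto simp: mult_ac)
    also have "\<dots> = (\<Sum>p | fst p * snd p = n. \<Sum>q | fst q * snd q = snd p.
           coeff f (fst p) * (coeff g (fst q) * coeff h (snd q)))"
      using fin by (subst sum.Sigma) (auto simp: case_prod_unfold)
    also have "\<dots> = coeff (f * (g * h)) n"
      by (simp add: times_dser.rep_eq sum_distrib_left case_prod_unfold)
    finally show "coeff (f * g * h) n = coeff (f * (g * h)) n" .
  qed
  show "f * g = g * f"
  proof transfer
    fix f g :: "nat \<Rightarrow> complex"
    show "(\<lambda>n. \<Sum>(a, b) | a * b = n. f a * g b) = (\<lambda>n. \<Sum>(a, b) | a * b = n. g a * f b)"
      by (intro ext sum.reindex_bij_witness[of _ prod.swap prod.swap]) (auto simp: mult_ac)
  qed
  show "1 * f = f"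
  proof (rule dser_eqI)
    fix n :: nat assume n: "n > 0"
    have "coeff (1 * f) n = (\<Sum>p | fst p * snd p = n. if p = (1, n) then coeff f n else 0)"
      unfolding times_dser.rep_eq one_dser.rep_eq case_prod_unfold
      by (intro sum.cong) auto
    also have "\<dots> = coeff f n"
      using finite_mult_pairs[OF n] by (subst sum.delta) (auto simp: case_prod_unfold)
    finally show "coeff (1 * f) n = coeff f n" .
  qed
  show "(f + g) * h = f * h + g * h"
    by transfer (simp add: algebra_simps case_prod_unfold sum.distrib)
  show "f + g + h = f + (g + h)" "f + g = g + f" "0 + f = f" "- f + f = 0" "f - g = f + - g"
    by (transfer; simp add: algebra_simps)+
  show "(0::dser) \<noteq> 1"
    by transfer (auto dest: fun_cong[of _ _ 1])
qed

end

lemma coeff_zero [simp]: "coeff 0 n = 0"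
  by transfer simp

lemma coeff_add [simp]: "coeff (f + g) n = coeff f n + coeff g n"
  by transfer simp

lemma coeff_diff [simp]: "coeff (f - g) n = coeff f n - coeff g n"
  by transfer simp

lemma coeff_one: "coeff 1 n = (if n = 1 then 1 else 0)"
  by transfer simp

lemma coeff_sum: "coeff (\<Sum>i\<in>A. F i) n = (\<Sum>i\<in>A. coeff (F i) n)"
  by (induction A rule: infinite_finite_induct) auto

lemma coeff_mult: "coeff (f * g) n = (\<Sum>(a, b) | a * b = n. coeff f a * coeff g b)"
  by transfer simp

lemma coeff_mult_1: "coeff (f * g) 1 = coeff f 1 * coeff g 1"
proof -
  have "{(a, b). a * b = (1::nat)} = {(1, 1)}"
    by auto
  then show ?thesis
    by (simp add: coeff_mult)
qed

lemma coeff_power_1: "coeff (f ^ k) 1 = coeff f 1 ^ k"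
  by (induction k) (simp_all add: coeff_mult_1 coeff_one del: One_nat_def)

text \<open>Scalars embedded as multiples of the unit, so that linear combinations stay inside the
  ring.\<close>

lift_definition dconst :: "complex \<Rightarrow> dser" is "\<lambda>c n. if n = 1 then c else 0"
  by simp

lemma coeff_dconst_mult [simp]: "coeff (dconst c * f) n = c * coeff f n"
proof (cases "n = 0")
  case False
  then have "coeff (dconst c * f) n = (\<Sum>p | fst p * snd p = n. if p = (1, n) then c * coeff f n else 0)"
    unfolding coeff_mult dconst.rep_eq case_prod_unfold
    by (intro sum.cong) auto
  also have "\<dots> = c * coeff f n"
    using finite_mult_pairs[of n] False by (subst sum.delta) (auto simp: case_prod_unfold)
  finally show ?thesis .
qed simp

lemma dconst_1 [simp]: "dconst 1 = 1"
  by transfer simp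

lemma dconst_add: "dconst (a + b) = dconst a + dconst b"
  by transfer auto

lemma dconst_mult: "dconst (a * b) = dconst a * dconst b"
  by (rule dser_eqI) (simp add: dconst.rep_eq)

lemma dconst_of_nat: "dconst (of_nat k) = of_nat k"
  by (induction k) (auto simp: dconst_add, transfer, auto)

section \<open>The logarithmic derivation\<close>

text \<open>On Dirichlet series this operator is \<open>- d/ds\<close>.\<close>

lift_definition dderiv :: "dser \<Rightarrow> dser" is "\<lambda>f n. of_real (ln (real n)) * f n"
  by simp

lemma coeff_dderiv: "coeff (dderiv f) n = of_real (ln (real n)) * coeff f n"
  by transfer simp

lemma dderiv_mult: "dderiv (f * g) = dderiv f * g + f * dderiv g"
proof (rule dser_eqI)
  fix n :: nat assume n: "n > 0"
  have "of_real (ln (real n)) * (coeff f a * coeff g b) =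
      coeff (dderiv f) a * coeff g b + coeff f a * coeff (dderiv g) b" if "a * b = n" for a b
  proof -
    have "a > 0" "b > 0"
      using that n by (auto intro: Nat.gr0I)
    then have "ln (real n) = ln (real a) + ln (real b)"
      using that by (auto simp: ln_mult)
    then show ?thesis
      by (simp add: coeff_dderiv algebra_simps)
  qed
  then show "coeff (dderiv (f * g)) n = coeff (dderiv f * g + f * dderiv g) n"
    by (auto simp: coeff_dderiv[of "f * g"] coeff_mult sum_distrib_left sum.distrib[symmetric]
          intro!: sum.cong)
qed

lemma dderiv_one [simp]: "dderiv 1 = 0"
  by (rule dser_eqI) (simp add: coeff_dderiv coeff_one)

lemma dderiv_diff: "dderiv (f - g) = dderiv f - dderiv g"
  by (rule dser_eqI) (simp add: coeff_dderiv algebra_simps)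

lemma dderiv_dconst_mult: "dderiv (dconst c * f) = dconst c * dderiv f"
  by (rule dser_eqI) (simp add: coeff_dderiv)

lemma dderiv_sum: "dderiv (\<Sum>i\<in>A. F i) = (\<Sum>i\<in>A. dderiv (F i))"
  by (rule dser_eqI) (simp add: coeff_dderiv coeff_sum sum_distrib_left)

lemma dderiv_power: "dderiv (f ^ k) = of_nat k * f ^ (k - 1) * dderiv f"
proof (induction k)
  case (Suc k)
  have "f * (of_nat k * f ^ (k - 1)) = of_nat k * f ^ k"
    by (cases k) (auto simp: algebra_simps)
  then have "dderiv (f ^ Suc k) = dderiv f * f ^ k + of_nat k * f ^ k * dderiv f"
    using Suc.IH by (simp only: power_Suc dderiv_mult mult.assoc[symmetric])
  then show ?case
    by (simp add: algebra_simps)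
qed simp

text \<open>Since \<open>ln n\<close> is nonzero for \<open>n > 1\<close>, the derivation forgets
  only the coefficient at 1. The bound \<open>x\<close> makes the test available for identities that
  hold only up to a threshold.\<close>

lemma dser_eqI_dderiv:
  assumes "\<And>n. n > 0 \<Longrightarrow> real n \<le> x \<Longrightarrow> coeff (dderiv f) n = coeff (dderiv g) n"
    and "coeff f 1 = coeff g 1" and "real n \<le> x"
  shows "coeff f n = coeff g n"
proof (cases "n \<le> 1")
  case True
  then show ?thesis
    using assms(2) by (cases "n = 0") (auto simp: le_Suc_eq)
next
  case False
  then have "ln (real n) \<noteq> 0"
    by simp
  then show ?thesis
    using assms(1)[of n] assms(3) False by (simp add: coeff_dderiv)
qed

section \<open>Generalized divisor functions as solutions of a differential equation\<close>

lift_definition dmangoldt :: dser is mangoldt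
  by simp

lift_definition dzeta :: dser is "\<lambda>n. if n = 0 then 0 else 1"
  by simp

lemma coeff_dzeta: "coeff dzeta n = (if n = 0 then 0 else 1)"
  by transfer simp

text \<open>The coefficient of \<open>n\<close> in
  \<open>dderiv f = dconst z * dmangoldt * f\<close>, solved for \<open>f n\<close>. As the von
  Mangoldt function vanishes at 1, only proper divisors \<open>d\<close> occur on the right.\<close>

function tau :: "complex \<Rightarrow> nat \<Rightarrow> complex" where
  "tau z n = (if n = 0 then 0 else if n = 1 then 1 else
     z / of_real (ln (real n)) * (\<Sum>d | d dvd n \<and> d < n. mangoldt (n div d) * tau z d))"
  by auto
termination
  by (relation "Wellfounded.measure snd") auto

declare tau.simps [simp del]

lift_definition dtau :: "complex \<Rightarrow> dser" is tau
  by (simp add: tau.simps)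

lemma dtau_1: "coeff (dtau z) 1 = 1"
  by (simp add: dtau.rep_eq tau.simps)

text \<open>The factor \<open>a = 1\<close> drops out because the von Mangoldt function vanishes there.\<close>

lemma coeff_dmangoldt_mult:
  assumes "n > 0"
  shows "coeff (dmangoldt * f) n = (\<Sum>d | d dvd n \<and> d < n. mangoldt (n div d) * coeff f d)"
proof -
  have "coeff (dmangoldt * f) n = (\<Sum>(a, b) \<in> {(a, b). a * b = n \<and> b < n}. mangoldt a * coeff f b)"
    unfolding coeff_mult dmangoldt.rep_eq
  proof (rule sum.mono_neutral_right)
    show "finite {(a, b). a * b = n}"
      by (rule finite_mult_pairs[OF assms])
    have "a = 1" if "a * b = n" "\<not> b < n" for a b
      using that assms by (cases a) auto
    then show "\<forall>i\<in>{(a, b). a * b = n} - {(a, b). a * b = n \<and> b < n}.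
        (case i of (a, b) \<Rightarrow> mangoldt a * coeff f b) = 0"
      by fastforce
  qed auto
  also have "\<dots> = (\<Sum>d | d dvd n \<and> d < n. mangoldt (n div d) * coeff f d)"
    using assms by (intro sum.reindex_bij_witness[of _ "\<lambda>d. (n div d, d)" snd]) auto
  finally show ?thesis .
qed

lemma dderiv_dtau: "dderiv (dtau z) = dconst z * dmangoldt * dtau z"
proof (rule dser_eqI)
  fix n :: nat assume n: "n > 0"
  show "coeff (dderiv (dtau z)) n = coeff (dconst z * dmangoldt * dtau z) n"
  proof (cases "n = 1")
    case False
    then have "ln (real n) \<noteq> 0"
      using n by simp
    then show ?thesis
      using n False
      by (simp add: coeff_dderiv mult.assoc coeff_dmangoldt_mult dtau.rep_eq tau.simps[of z n])
  qed (simp add: coeff_dderiv coeff_dmangoldt_mult mult.assoc)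
qed

text \<open>The equation at \<open>n > 1\<close> determines the coefficient of \<open>n\<close> from
  those of proper divisors, so strong induction starting from the value at 1 applies.\<close>

lemma dtau_unique:
  assumes "dderiv f = dconst z * dmangoldt * f" and "coeff f 1 = 1"
  shows "f = dtau z"
proof (rule dser_eqI)
  fix n :: nat assume "n > 0"
  then show "coeff f n = coeff (dtau z) n"
  proof (induction n rule: less_induct)
    case (less n)
    show ?case
    proof (cases "n = 1")
      case False
      have "of_real (ln (real n)) * coeff f n =
          z * (\<Sum>d | d dvd n \<and> d < n. mangoldt (n div d) * coeff f d)"
        using less.prems
        by (simp add: assms(1) coeff_dderiv[symmetric] mult.assoc coeff_dmangoldt_mult)
      also have "(\<Sum>d | d dvd n \<and> d < n. mangoldt (n div d) * coeff f d) =
          (\<Sum>d | d dvd n \<and> d < n. mangoldt (n div d) * coeff (dtau z) d)"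
        using less by (intro sum.cong) (auto intro!: less.IH intro: Nat.gr0I)
      also have "z * \<dots> = of_real (ln (real n)) * coeff (dtau z) n"
        using less.prems
        by (simp add: dderiv_dtau coeff_dderiv[symmetric] mult.assoc coeff_dmangoldt_mult)
      finally show ?thesis
        using False less.prems by simp
    qed (use assms(2) in \<open>simp add: dtau_1 del: One_nat_def\<close>)
  qed
qed

text \<open>By the Leibniz rule the product solves the equation with parameter
  \<open>z + w\<close>.\<close>

lemma dtau_add: "dtau (z + w) = dtau z * dtau w"
  by (rule dtau_unique[symmetric])
     (simp_all add: dderiv_mult dderiv_dtau dconst_add algebra_simps coeff_mult_1 dtau_1 del: One_nat_def)

lemma dtau_zero: "dtau 0 = 1"
proof (rule dtau_unique[symmetric])
  have "dconst 0 = 0"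
    by transfer auto
  then show "dderiv 1 = dconst 0 * dmangoldt * 1"
    by simp
qed (simp add: coeff_one)

text \<open>For the constant function 1 the equation is the identity that the von Mangoldt function
  summed over the divisors of \<open>n\<close> gives \<open>ln n\<close>.\<close>

lemma dtau_one: "dtau 1 = dzeta"
proof (rule dtau_unique[symmetric])
  show "dderiv dzeta = dconst 1 * dmangoldt * dzeta"
  proof (rule dser_eqI)
    fix n :: nat assume n: "n > 0"
    have "coeff (dmangoldt * dzeta) n = (\<Sum>d | d dvd n. mangoldt d)"
      unfolding coeff_mult dmangoldt.rep_eq coeff_dzeta case_prod_unfold
      using n by (intro sum.reindex_bij_witness[of _ "\<lambda>d. (d, n div d)" fst]) auto
    then show "coeff (dderiv dzeta) n = coeff (dconst 1 * dmangoldt * dzeta) n"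
      using n by (simp add: coeff_dderiv coeff_dzeta mangoldt_sum)
  qed
qed (simp add: coeff_dzeta)

lemma dtau_mult_of_nat: "dtau (of_nat k * z) = dtau z ^ k"
  by (induction k) (simp_all add: dtau_zero dtau_add distrib_right)

lemma dtau_of_nat: "dtau (of_nat k) = dzeta ^ k"
  using dtau_mult_of_nat[of k 1] by (simp add: dtau_one)

section \<open>Dirichlet series\<close>

definition dterm :: "dser \<Rightarrow> complex \<Rightarrow> nat \<Rightarrow> complex" where
  "dterm f s n = coeff f n * of_nat n powr (- s)"

definition deval :: "dser \<Rightarrow> complex \<Rightarrow> complex" where
  "deval f s = (\<Sum>\<^sub>\<infinity>n. dterm f s n)"

text \<open>Summability of complex terms is absolute, and the norms depend on \<open>Re s\<close>
  only; real exponents above 1 therefore suffice to test it.\<close>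

definition dconv :: "dser \<Rightarrow> bool" where
  "dconv f \<longleftrightarrow> (\<forall>s. Re s > 1 \<longrightarrow> dterm f s summable_on UNIV)"

lemma dterm_0 [simp]: "dterm f s 0 = 0"
  by (simp add: dterm_def)

lemma norm_dterm: "norm (dterm f s n) = norm (coeff f n) * real n powr (- Re s)"
  by (simp add: dterm_def norm_mult norm_powr_real_powr)

lemma dconvD: "dconv f \<Longrightarrow> Re s > 1 \<Longrightarrow> (dterm f s has_sum deval f s) UNIV"
  by (simp add: dconv_def deval_def summable_iff_has_sum_infsum)

lemma dconvD_norm: "dconv f \<Longrightarrow> \<sigma> > 1 \<Longrightarrow> (\<lambda>n. norm (coeff f n) * real n powr (- \<sigma>)) summable_on UNIV"
  unfolding dconv_def
  by (drule spec[of _ "of_real \<sigma>"])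
     (simp add: summable_on_iff_abs_summable_on_complex norm_dterm)

lemma dconvI_norm:
  assumes "\<And>\<sigma>. \<sigma> > 1 \<Longrightarrow> (\<lambda>n. norm (coeff f n) * real n powr (- \<sigma>)) summable_on UNIV"
  shows "dconv f"
  using assms by (simp add: dconv_def summable_on_iff_abs_summable_on_complex norm_dterm)

lemma dconv_mono:
  assumes "dconv g" and "\<And>n. norm (coeff f n) \<le> norm (coeff g n)"
  shows "dconv f"
proof (rule dconvI_norm)
  fix \<sigma> :: real assume "\<sigma> > 1"
  then show "(\<lambda>n. norm (coeff f n) * real n powr (- \<sigma>)) summable_on UNIV"
    by (rule summable_on_comparison_test[OF dconvD_norm[OF assms(1)]])
       (auto intro: mult_right_mono assms(2))
qed

text \<open>The double series converges absolutely, so its terms may be regrouped according to the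
  product \<open>n = a * b\<close>.\<close>

lemma has_sum_dterm_mult:
  assumes "dconv f" "dconv g" "Re s > 1"
  shows "(dterm (f * g) s has_sum deval f s * deval g s) UNIV"
proof -
  let ?h = "\<lambda>(a, b). dterm f s a * dterm g s b"
  have f: "(\<lambda>n. norm (dterm f s n)) summable_on UNIV"
    and g: "(\<lambda>n. norm (dterm g s n)) summable_on UNIV"
    using assms by (simp_all add: dconv_def summable_on_iff_abs_summable_on_complex[symmetric])
  have "(\<lambda>p. norm (?h p)) summable_on Sigma UNIV (\<lambda>_. UNIV)"
    unfolding Infinite_Sum.abs_summable_on_Sigma_iff
  proof (intro conjI ballI)
    fix a
    show "(\<lambda>b. norm (?h (a, b))) summable_on UNIV"
      using summable_on_cmult_right[OF g] by (simp add: norm_mult)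
  next
    have "(\<lambda>a. norm (dterm f s a) * (\<Sum>\<^sub>\<infinity>b. norm (dterm g s b))) summable_on UNIV"
      by (rule summable_on_cmult_left[OF f])
    then show "(\<lambda>a. norm (\<Sum>\<^sub>\<infinity>b. norm (?h (a, b)))) summable_on UNIV"
      by (simp add: norm_mult infsum_cmult_right' abs_mult infsum_nonneg)
  qed
  then have "?h summable_on Sigma UNIV (\<lambda>_. UNIV)"
    by (simp add: summable_on_iff_abs_summable_on_complex)
  then have "(?h has_sum deval f s * deval g s) (Sigma UNIV (\<lambda>_. UNIV))"
    using dconvD[OF assms(1,3)] dconvD[OF assms(2,3)]
    by (intro has_sum_SigmaI[where g = "\<lambda>a. dterm f s a * deval g s"])
       (auto intro: has_sum_cmult_right has_sum_cmult_left)
  then have "((\<lambda>(n, p). ?h p) has_sum deval f s * deval g s)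
      (Sigma UNIV (\<lambda>n. {(a, b). a * b = n}))"
    by (subst (asm) has_sum_reindex_bij_witness
          [of _ snd "\<lambda>p. (fst p * snd p, p)" "Sigma UNIV (\<lambda>n. {(a, b). a * b = n})" "\<lambda>(n, p). ?h p"]) auto
  then show ?thesis
  proof (rule has_sum_SigmaD)
    fix n :: nat
    show "((\<lambda>p. case (n, p) of (n, p) \<Rightarrow> ?h p) has_sum dterm (f * g) s n) {(a, b). a * b = n}"
    proof (cases "n = 0")
      \<comment> \<open>The fibre over 0 is infinite, but each of its terms has a factor at index 0,
        which vanishes.\<close>
      case True
      then show ?thesis
        by (auto intro!: has_sum_0)
    next
      case False
      have "dterm (f * g) s n = (\<Sum>p\<in>{(a, b). a * b = n}. ?h p)"
        by (auto simp: dterm_def coeff_mult sum_distrib_right powr_times_real intro!: sum.cong)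
      then show ?thesis
        using finite_mult_pairs[of n] False by simp
    qed
  qed
qed

lemma dconv_mult: "dconv f \<Longrightarrow> dconv g \<Longrightarrow> dconv (f * g)"
  using has_sum_dterm_mult unfolding dconv_def summable_on_def by blast

lemma deval_mult: "dconv f \<Longrightarrow> dconv g \<Longrightarrow> Re s > 1 \<Longrightarrow> deval (f * g) s = deval f s * deval g s"
  using has_sum_dterm_mult[of f g s] by (simp add: deval_def infsumI)

lemma deval_dconst_mult: "deval (dconst c * f) s = c * deval f s"
  by (simp add: deval_def dterm_def mult.assoc infsum_cmult_right')

lemma dconv_dconst_mult: "dconv f \<Longrightarrow> dconv (dconst c * f)"
  unfolding dconv_def dterm_def[abs_def] coeff_dconst_mult mult.assoc
  by (intro allI impI summable_on_cmult_right) simp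

lemma dconv_dzeta: "dconv dzeta"
proof (rule dconvI_norm)
  fix \<sigma> :: real assume "\<sigma> > 1"
  then have "(\<lambda>n. real n powr (- \<sigma>)) summable_on UNIV"
    by (subst summable_on_UNIV_nonneg_real_iff) (auto simp: summable_real_powr_iff)
  then show "(\<lambda>n. norm (coeff dzeta n) * real n powr (- \<sigma>)) summable_on UNIV"
    by (rule summable_on_comparison_test) (auto simp: coeff_dzeta)
qed

lemma dconv_one: "dconv 1"
  by (rule dconv_mono[OF dconv_dzeta]) (simp add: coeff_one coeff_dzeta)

text \<open>The logarithm is absorbed by \<open>ln n \<le> n powr e / e\<close>, where
  \<open>e\<close> is half the distance from \<sigma> to 1, so that \<sigma> - \<open>e\<close>
  still exceeds 1.\<close>

lemma dconv_dderiv: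
  assumes "dconv f"
  shows "dconv (dderiv f)"
proof (rule dconvI_norm)
  fix \<sigma> :: real assume \<sigma>: "\<sigma> > 1"
  define e where "e = (\<sigma> - 1) / 2"
  have e: "e > 0" "\<sigma> - e > 1"
    using \<sigma> by (auto simp: e_def field_simps)
  have "(\<lambda>n. 1 / e * (norm (coeff f n) * real n powr (- (\<sigma> - e)))) summable_on UNIV"
    using e by (intro summable_on_cmult_right dconvD_norm[OF assms])
  then show "(\<lambda>n. norm (coeff (dderiv f) n) * real n powr (- \<sigma>)) summable_on UNIV"
  proof (rule summable_on_comparison_test)
    fix n :: nat
    show "norm (coeff (dderiv f) n) * real n powr (- \<sigma>) \<le>
        1 / e * (norm (coeff f n) * real n powr (- (\<sigma> - e)))"
    proof (cases "n = 0")
      case False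
      then have "\<bar>ln (real n)\<bar> \<le> real n powr e / e"
        using ln_powr_bound[of "real n" e] e by simp
      then have "\<bar>ln (real n)\<bar> * (norm (coeff f n) * real n powr (- \<sigma>)) \<le>
          real n powr e / e * (norm (coeff f n) * real n powr (- \<sigma>))"
        by (rule mult_right_mono) simp
      also have "\<dots> = 1 / e * (norm (coeff f n) * (real n powr e * real n powr (- \<sigma>)))"
        by (simp add: algebra_simps)
      also have "real n powr e * real n powr (- \<sigma>) = real n powr (- (\<sigma> - e))"
        by (simp add: powr_add[symmetric])
      finally show ?thesis
        by (simp add: coeff_dderiv norm_mult mult.assoc)
    qed simp
  qed simp
qed

section \<open>Differentiation and uniqueness of Dirichlet series\<close>

text \<open>Termwise differentiation on the half-plane to the right of \<sigma>, the midpoint of 1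
  and \<open>Re s\<close>, where the terms at \<sigma> give a uniform summable majorant.\<close>

lemma deval_has_field_derivative:
  assumes "dconv f" "Re s > 1"
  shows "(deval f has_field_derivative - deval (dderiv f) s) (at s)"
proof -
  define \<sigma> where "\<sigma> = (1 + Re s) / 2"
  define S where "S = {z. Re z > \<sigma>}"
  have \<sigma>: "\<sigma> > 1" "\<sigma> < Re s"
    using assms(2) by (auto simp: \<sigma>_def field_simps)
  have S: "open S" "s \<in> S"
    using \<sigma> by (auto simp: S_def open_halfspace_Re_gt)
  have sum: "summable (\<lambda>n. norm (coeff f n) * real n powr (- \<sigma>))"
    using dconvD_norm[OF assms(1) \<sigma>(1)] by (rule summable_on_imp_summable)
  have der: "((\<lambda>z. dterm f z n) has_field_derivative - dterm (dderiv f) z n) (at z)" for n z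
  proof (cases "n = 0")
    case False
    then have "(\<lambda>z. dterm f z n) = (\<lambda>z. coeff f n * exp (- z * of_real (ln (real n))))"
      by (simp add: dterm_def powr_def)
    moreover have "dterm (dderiv f) z n =
        of_real (ln (real n)) * (coeff f n * exp (- z * of_real (ln (real n))))"
      using False by (simp add: dterm_def powr_def coeff_dderiv)
    ultimately show ?thesis
      by (auto intro!: derivative_eq_intros)
  qed simp
  have bound: "\<forall>z\<in>S. norm (dterm f z n) \<le> norm (coeff f n) * real n powr (- \<sigma>)" for n
  proof
    fix z assume "z \<in> S"
    then show "norm (dterm f z n) \<le> norm (coeff f n) * real n powr (- \<sigma>)"
      unfolding norm_dterm S_def
      by (cases "n = 0") (auto intro!: mult_left_mono powr_mono)
  qed
  obtain g g' where g: "\<forall>z\<in>S. (\<lambda>n. dterm f z n) sums g z \<and>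
      (\<lambda>n. - dterm (dderiv f) z n) sums g' z \<and> (g has_field_derivative g' z) (at z)"
    by (rule series_and_derivative_comparison[OF S(1) sum, of "\<lambda>n z. dterm f z n"
          "\<lambda>n z. - dterm (dderiv f) z n"]) (use der bound in auto)
  have "g z = deval f z" if "z \<in> S" for z
    using g that \<sigma> has_sum_imp_sums[OF dconvD[OF assms(1), of z]]
    by (auto simp: S_def dest: sums_unique2)
  moreover have "g' s = - deval (dderiv f) s"
    using g S sums_minus[OF has_sum_imp_sums[OF dconvD[OF dconv_dderiv[OF assms(1)] assms(2)]]]
    by (auto dest: sums_unique2)
  ultimately show ?thesis
    using g S has_field_derivative_transform_within_open[of g "g' s" s S "deval f"] by auto
qed

text \<open>The first possible term dominates for large real \<open>t\<close>. The terms beyond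
  \<open>N\<close> are compared with the convergent series at 2, which leaves an error of order
  \<open>(N / (N + 1)) powr t\<close>.\<close>

lemma deval_asymptotics:
  assumes f: "dconv f" and N: "N > 0" and zero: "\<And>n. n < N \<Longrightarrow> coeff f n = 0"
  shows "((\<lambda>t. of_real (real N powr t) * deval f (of_real t)) \<longlongrightarrow> coeff f N) at_top"
proof -
  define B where "B = (\<Sum>\<^sub>\<infinity>n\<in>UNIV - {N}. norm (coeff f n) * real n powr (- 2))"
  define q where "q = real N / real (Suc N)"
  have bound: "norm (of_real (real N powr t) * deval f (of_real t) - coeff f N) \<le>
      real (Suc N) powr 2 * B * q powr t" if t: "t \<ge> 2" for t
  proof -
    have t1: "Re (of_real t) > 1"
      using t by simp
    have sum: "dterm f (of_real t) summable_on UNIV - {N}"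
      by (rule summable_on_subset_banach[of _ UNIV]) (use f t1 in \<open>simp_all add: dconv_def\<close>)
    have sum2: "(\<lambda>n. norm (coeff f n) * real n powr (- 2)) summable_on UNIV - {N}"
      by (rule summable_on_subset_banach[OF dconvD_norm[OF f]]) auto
    have le: "norm (dterm f (of_real t) n) \<le>
        real (Suc N) powr (2 - t) * (norm (coeff f n) * real n powr (- 2))" if "n \<in> UNIV - {N}" for n
    proof (cases "n < N")
      case True
      then show ?thesis
        by (simp add: norm_dterm zero)
    next
      case False
      then have n: "n \<ge> Suc N"
        using that by auto
      \<comment> \<open>Two powers are kept for summability over \<open>n\<close>; the remaining
        exponent \<open>2 - t\<close> is nonpositive, so its power is largest at
        \<open>n = Suc N\<close>.\<close>
      have "real n powr (- t) = real n powr (2 - t) * real n powr (- 2)"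
        by (simp add: powr_add[symmetric])
      also have "\<dots> \<le> real (Suc N) powr (2 - t) * real n powr (- 2)"
        using n t by (intro mult_right_mono powr_mono2') auto
      finally have "norm (coeff f n) * real n powr (- t) \<le>
          norm (coeff f n) * (real (Suc N) powr (2 - t) * real n powr (- 2))"
        by (rule mult_left_mono) simp
      then show ?thesis
        by (simp add: norm_dterm mult_ac)
    qed
    have "deval f (of_real t) = dterm f (of_real t) N + infsum (dterm f (of_real t)) (UNIV - {N})"
      unfolding deval_def using infsum_insert[OF sum, of N] by (simp add: insert_absorb)
    moreover have "of_real (real N powr t) * dterm f (of_real t) N = coeff f N"
    proof -
      have "of_nat N powr (- of_real t :: complex) = of_real (real N powr (- t))"
        by (metis of_nat_0_le_iff of_real_minus of_real_of_nat_eq powr_of_real)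
      then have "of_real (real N powr t) * dterm f (of_real t) N =
          coeff f N * of_real (real N powr t * real N powr (- t))"
        by (simp only: dterm_def of_real_mult mult_ac)
      also have "real N powr t * real N powr (- t) = 1"
        using N by (simp add: powr_add[symmetric])
      finally show ?thesis
        by simp
    qed
    ultimately have "of_real (real N powr t) * deval f (of_real t) - coeff f N =
        of_real (real N powr t) * infsum (dterm f (of_real t)) (UNIV - {N})"
      by (simp add: distrib_left)
    then have "norm (of_real (real N powr t) * deval f (of_real t) - coeff f N) =
        real N powr t * norm (infsum (dterm f (of_real t)) (UNIV - {N}))"
      by (simp add: norm_mult)
    also have "norm (infsum (dterm f (of_real t)) (UNIV - {N})) \<le>
        (\<Sum>\<^sub>\<infinity>n\<in>UNIV - {N}. norm (dterm f (of_real t) n))"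
      using sum by (intro norm_infsum_bound) (simp add: summable_on_iff_abs_summable_on_complex)
    also have "\<dots> \<le> (\<Sum>\<^sub>\<infinity>n\<in>UNIV - {N}. real (Suc N) powr (2 - t) * (norm (coeff f n) * real n powr (- 2)))"
      using sum le by (intro infsum_mono summable_on_cmult_right sum2)
        (simp_all add: summable_on_iff_abs_summable_on_complex)
    also have "\<dots> = real (Suc N) powr (2 - t) * B"
      unfolding B_def by (rule infsum_cmult_right')
    also have "real N powr t * (real (Suc N) powr (2 - t) * B) = real (Suc N) powr 2 * B * q powr t"
      using N by (simp add: q_def powr_diff powr_divide)
    finally show ?thesis
      by (simp add: mult_left_mono)
  qed
  have q: "0 < q" "q < 1"
    using N by (auto simp: q_def)
  have "((\<lambda>t. q powr t) \<longlongrightarrow> 0) at_top"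
    using q by real_asymp
  then have "((\<lambda>t. real (Suc N) powr 2 * B * q powr t) \<longlongrightarrow> 0) at_top"
    by (rule tendsto_mult_right_zero)
  then have "((\<lambda>t. of_real (real N powr t) * deval f (of_real t) - coeff f N) \<longlongrightarrow> 0) at_top"
    by (rule Lim_null_comparison[rotated]) (use bound in \<open>auto intro: eventually_at_top_linorderI\<close>)
  then show ?thesis
    by (rule LIM_zero_cancel)
qed

text \<open>The first nonzero coefficient would be the limit of a rescaled series that is
  identically 0.\<close>

lemma dser_eq_0I:
  assumes "dconv f" "\<And>s. Re s > 1 \<Longrightarrow> deval f s = 0"
  shows "f = 0"
proof (rule ccontr)
  assume "f \<noteq> 0"
  then have ex: "\<exists>n. coeff f n \<noteq> 0"
    using dser_eqI[of f 0] by auto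
  define N where "N = (LEAST n. coeff f n \<noteq> 0)"
  have N: "coeff f N \<noteq> 0"
    unfolding N_def by (rule LeastI_ex[OF ex])
  have "((\<lambda>t. of_real (real N powr t) * deval f (of_real t)) \<longlongrightarrow> coeff f N) at_top"
    using N by (intro deval_asymptotics[OF assms(1)])
      (auto simp: N_def dest: not_less_Least intro: Nat.gr0I)
  moreover have "((\<lambda>t. of_real (real N powr t) * deval f (of_real t)) \<longlongrightarrow> 0) at_top"
    using assms(2) by (intro tendsto_eventually) (auto intro!: eventually_at_top_linorderI[of 2])
  ultimately have "coeff f N = 0"
    by (rule tendsto_unique[rotated]) simp
  with N show False ..
qed

text \<open>The recursion for \<open>tau\<close> has nonnegative weights, so \<open>\<tau>\<^sub>z\<close> is majorised by \<open>\<tau>\<^sub>x\<close> for \<open>x \<ge> \<bar>z\<bar>\<close>.\<close>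

lemma norm_tau_le: "norm z \<le> x \<Longrightarrow> norm (tau z n) \<le> Re (tau (of_real x) n)"
proof (induction n rule: less_induct)
  case (less n)
  show ?case
  proof (cases "n \<le> 1")
    case True
    then show ?thesis
      by (cases "n = 0") (auto simp: tau.simps le_Suc_eq)
  next
    case False
    have sum: "norm (\<Sum>d | d dvd n \<and> d < n. mangoldt (n div d) * tau z d) \<le>
        (\<Sum>d | d dvd n \<and> d < n. mangoldt (n div d) * Re (tau (of_real x) d))"
      using less by (intro sum_norm_le) (auto simp: norm_mult intro!: mult_left_mono mangoldt_nonneg)
    have "x \<ge> 0"
      using less.prems norm_ge_zero[of z] by linarith
    have "norm (tau z n) =
        norm z / ln (real n) * norm (\<Sum>d | d dvd n \<and> d < n. mangoldt (n div d) * tau z d)"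
      using False by (simp add: tau.simps[of z n] norm_mult norm_divide)
    also have "\<dots> \<le> x / ln (real n) *
        (\<Sum>d | d dvd n \<and> d < n. mangoldt (n div d) * Re (tau (of_real x) d))"
      using False sum less.prems \<open>x \<ge> 0\<close> by (intro mult_mono divide_right_mono) auto
    also have "\<dots> = Re (tau (of_real x) n)"
      using False by (simp add: tau.simps[of "of_real x" n] of_real_divide[symmetric] del: of_real_divide)
    finally show ?thesis .
  qed
qed

text \<open>For a natural number \<open>k\<close> above the norm of \<open>z\<close>, the majorant
  is the \<open>k\<close>-th convolution power of \<open>dzeta\<close>, whose convergence follows
  from that of products.\<close>

lemma dconv_dtau: "dconv (dtau z)"
proof -
  obtain k :: nat where k: "norm z \<le> real k"
    using real_arch_simple by blast
  have "dconv (dzeta ^ k)"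
    by (induction k) (auto intro: dconv_one dconv_mult dconv_dzeta)
  then show ?thesis
  proof (rule dconv_mono)
    fix n
    have "norm (coeff (dtau z) n) \<le> Re (coeff (dtau (of_nat k)) n)"
      using norm_tau_le[OF k, of n] by (simp add: dtau.rep_eq)
    also have "\<dots> \<le> norm (coeff (dzeta ^ k) n)"
      by (simp add: dtau_of_nat complex_Re_le_cmod)
    finally show "norm (coeff (dtau z) n) \<le> norm (coeff (dzeta ^ k) n)" .
  qed
qed

section \<open>The logarithm of zeta and the identification of \<open>gen_divisor\<close>\<close>

text \<open>The coefficients of the logarithm of zeta: \<open>1 / k\<close> at a prime power
  \<open>p ^ k\<close> with \<open>k \<ge> 1\<close>, and 0 elsewhere. At \<open>n = 1\<close> the
  quotient is \<open>0 / 0 = 0\<close>.\<close>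

lift_definition dlog :: dser is "\<lambda>n. mangoldt n / of_real (ln (real n))"
  by simp

lemma dderiv_dlog: "dderiv dlog = dmangoldt"
proof (rule dser_eqI)
  fix n :: nat assume "n > 0"
  then show "coeff (dderiv dlog) n = coeff dmangoldt n"
    by (cases "n = 1") (simp_all add: coeff_dderiv dlog.rep_eq dmangoldt.rep_eq)
qed

lemma dconv_dlog: "dconv dlog"
proof (rule dconv_mono[OF dconv_dzeta])
  fix n :: nat
  have "norm (coeff dlog n) \<le> 1" if "n > 0"
    using that mangoldt_le[of n]
    by (cases "n = 1") (auto simp: dlog.rep_eq norm_divide divide_le_eq_1)
  then show "norm (coeff dlog n) \<le> norm (coeff dzeta n)"
    by (cases "n = 0") (simp_all add: coeff_dzeta)
qed

text \<open>Both sides satisfy the same linear first-order equation in \<open>s\<close>, so their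
  quotient is constant on the half-plane.\<close>

lemma deval_dtau:
  assumes "Re s > 1"
  shows "deval (dtau z) s = exp (z * deval dlog s)"
proof -
  define S where "S = {s. Re s > 1}"
  have man: "dconv dmangoldt"
    using dconv_dderiv[OF dconv_dlog] by (simp add: dderiv_dlog)
  let ?h = "\<lambda>s. deval (dtau z) s * exp (- z * deval dlog s)"
  have "(?h has_field_derivative 0) (at s)" if "s \<in> S" for s
  proof -
    have s: "Re s > 1"
      using that by (simp add: S_def)
    have "deval (dderiv (dtau z)) s = z * deval dmangoldt s * deval (dtau z) s"
      by (simp add: dderiv_dtau deval_mult dconv_dconst_mult man dconv_dtau s deval_dconst_mult)
    moreover have "deval (dderiv dlog) s = deval dmangoldt s"
      by (simp add: dderiv_dlog)
    ultimately show ?thesis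
      using deval_has_field_derivative[OF dconv_dtau s, of z] deval_has_field_derivative[OF dconv_dlog s]
      by (auto intro!: derivative_eq_intros)
  qed
  then have "\<exists>c. \<forall>s\<in>S. ?h s = c"
    by (intro has_field_derivative_zero_constant)
       (auto simp: S_def convex_halfspace_Re_gt has_field_derivative_at_within)
  then obtain c where c: "\<And>s. s \<in> S \<Longrightarrow> ?h s = c"
    by blast
  \<comment> \<open>The constant is found by letting \<open>s\<close> tend to infinity along the
    reals, where only the coefficients at 1 survive: 1 for \<open>dtau z\<close> and 0 for
    \<open>dlog\<close>.\<close>
  have "((\<lambda>t. of_real (real 1 powr t) * deval (dtau z) (of_real t)) \<longlongrightarrow> coeff (dtau z) 1) at_top"
    by (rule deval_asymptotics[OF dconv_dtau]) auto
  then have "((\<lambda>t. deval (dtau z) (of_real t)) \<longlongrightarrow> 1) at_top"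
    by (simp add: dtau_1[simplified])
  moreover have "((\<lambda>t. of_real (real 1 powr t) * deval dlog (of_real t)) \<longlongrightarrow> coeff dlog 1) at_top"
    by (rule deval_asymptotics[OF dconv_dlog]) auto
  then have "((\<lambda>t. deval dlog (of_real t)) \<longlongrightarrow> 0) at_top"
    by (simp add: dlog.rep_eq)
  ultimately have "((\<lambda>t. ?h (of_real t)) \<longlongrightarrow> 1 * exp (- z * 0)) at_top"
    by (intro tendsto_intros)
  moreover have "((\<lambda>t. ?h (of_real t)) \<longlongrightarrow> c) at_top"
    by (intro tendsto_eventually eventually_at_top_linorderI[of 2] c) (simp add: S_def)
  ultimately have "c = 1"
    by (metis exp_zero mult_1 mult_zero_right tendsto_unique trivial_limit_at_top_linorder)
  then show ?thesis
    using c[of s] assms by (simp add: S_def exp_minus field_simps)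
qed

lemma zeta_eq_deval: "zeta s = deval dzeta s"
  unfolding zeta_def deval_def
  by (rule infsum_cong_neutral) (auto simp: dterm_def coeff_dzeta)

lemma deval_dlog_real:
  assumes "t > 1"
  shows "deval dlog (of_real t) \<in> \<real>"
proof -
  have "Im (dterm dlog (of_real t) n) = 0" for n
  proof -
    have "of_nat n powr (- of_real t :: complex) = of_real (real n powr (- t))"
      by (metis of_nat_0_le_iff of_real_minus of_real_of_nat_eq powr_of_real)
    then have "dterm dlog (of_real t) n = of_real (mangoldt n / ln (real n) * real n powr (- t))"
      by (simp add: dterm_def dlog.rep_eq)
    then show ?thesis
      by (simp only: Im_complex_of_real)
  qed
  moreover have "dterm dlog (of_real t) summable_on UNIV"
    using dconv_dlog assms by (simp add: dconv_def)
  ultimately have "Im (deval dlog (of_real t)) = 0"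
    unfolding deval_def by (subst infsum_Im[symmetric]) auto
  then show ?thesis
    by (simp add: complex_is_Real_iff)
qed

text \<open>Two holomorphic logarithms of zeta differ by a constant on the convex half-plane; as
  both are real at 2, where their exponentials agree, the constant is 0.\<close>

lemma ln_zeta_eq:
  assumes "Re s > 1"
  shows "ln_zeta s = deval dlog s"
proof -
  define S where "S = {s. Re s > 1}"
  define is_log where "is_log L \<longleftrightarrow> L holomorphic_on S \<and> (\<forall>s. Re s > 1 \<longrightarrow> exp (L s) = zeta s) \<and>
     (\<forall>t::real. t > 1 \<longrightarrow> L (of_real t) \<in> \<real>)" for L
  have open_S: "open S"
    by (simp add: S_def open_halfspace_Re_gt)
  have log: "is_log (deval dlog)"
    unfolding is_log_def holomorphic_on_open[OF open_S]
    using deval_has_field_derivative[OF dconv_dlog] deval_dlog_real deval_dtau[of _ 1]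
    by (auto simp: S_def zeta_eq_deval dtau_one)
  have "ln_zeta = (SOME L. is_log L)"
    by (simp add: ln_zeta_def is_log_def S_def)
  then have ln: "is_log ln_zeta"
    using someI[of is_log, OF log] by simp
  have "((\<lambda>s. ln_zeta s - deval dlog s) has_field_derivative 0) (at s)" if s: "s \<in> S" for s
  proof -
    obtain A B where A: "(ln_zeta has_field_derivative A) (at s)"
      and B: "(deval dlog has_field_derivative B) (at s)"
      using ln log s unfolding is_log_def holomorphic_on_open[OF open_S] by blast
    \<comment> \<open>Differentiating the common exponential and cancelling its nonzero value shows
      that the two derivatives agree.\<close>
    have dA: "((\<lambda>s. exp (ln_zeta s)) has_field_derivative exp (ln_zeta s) * A) (at s)"
      and dB: "((\<lambda>s. exp (deval dlog s)) has_field_derivative exp (deval dlog s) * B) (at s)"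
      using A B by (auto intro!: derivative_eq_intros)
    have eq: "exp (ln_zeta s) = exp (deval dlog s)" if "s \<in> S" for s
      using ln log that by (simp add: is_log_def S_def)
    have "exp (ln_zeta s) * A = exp (deval dlog s) * B"
      by (rule DERIV_unique[OF has_field_derivative_transform_within_open[OF dA open_S s eq] dB])
    then have "A = B"
      using eq[OF s] by simp
    then show ?thesis
      using A B by (auto intro!: derivative_eq_intros)
  qed
  then have "\<exists>c. \<forall>s\<in>S. ln_zeta s - deval dlog s = c"
    by (intro has_field_derivative_zero_constant)
       (auto simp: S_def convex_halfspace_Re_gt has_field_derivative_at_within)
  then obtain c where c: "\<And>s. s \<in> S \<Longrightarrow> ln_zeta s - deval dlog s = c"
    by blast
  have real: "L (of_real 2) \<in> \<real>" if "is_log L" for L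
    using that unfolding is_log_def by (elim conjE allE[of _ 2]) simp
  obtain a b where ab: "ln_zeta (of_real 2) = of_real a" "deval dlog (of_real 2) = of_real b"
    using real[OF ln] real[OF log] by (metis Reals_cases)
  have "exp (ln_zeta (of_real 2)) = exp (deval dlog (of_real 2))"
    using ln log unfolding is_log_def by simp
  then have "a = b"
    unfolding ab exp_of_real by simp
  then have "c = 0"
    using c[of "of_real 2"] unfolding ab by (simp add: S_def)
  then show ?thesis
    using c[of s] assms by (simp add: S_def)
qed

text \<open>The definite description is resolved by existence from \<open>deval_dtau\<close> and
  uniqueness from \<open>dser_eq_0I\<close>, applied to the difference of two candidates.\<close>

lemma gen_divisor_eq: "gen_divisor z = coeff (dtau z)"
proof -
  have iff: "((\<lambda>n. coeff f n * of_nat n powr (- s)) has_sum c) {1..} \<longleftrightarrow> (dterm f s has_sum c) UNIV"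
    for f s c
    by (rule has_sum_cong_neutral) (auto simp: dterm_def)
  have pow: "zeta_pow z s = deval (dtau z) s" if "Re s > 1" for s
    using that by (simp add: zeta_pow_def ln_zeta_eq deval_dtau)
  show ?thesis
    unfolding gen_divisor_def
  proof (rule the_equality, safe)
    fix s :: complex assume "Re s > 1"
    then show "((\<lambda>n. coeff (dtau z) n * of_nat n powr (- s)) has_sum zeta_pow z s) {1..}"
      by (simp only: iff pow dconvD[OF dconv_dtau])
  next
    fix a :: "nat \<Rightarrow> complex"
    assume a: "a 0 = 0"
      "\<forall>s. 1 < Re s \<longrightarrow> ((\<lambda>n. a n * of_nat n powr (- s)) has_sum zeta_pow z s) {1..}"
    define f where "f = Abs_dser a"
    have f: "coeff f = a"
      using a(1) by (simp add: f_def Abs_dser_inverse)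
    have "(dterm (f - dtau z) s has_sum 0) UNIV" if s: "Re s > 1" for s
    proof -
      have "(dterm f s has_sum zeta_pow z s) UNIV"
        using a(2) s by (simp add: f iff[symmetric])
      then have "((\<lambda>n. dterm f s n + - 1 * dterm (dtau z) s n) has_sum zeta_pow z s + - 1 * deval (dtau z) s) UNIV"
        by (intro has_sum_add has_sum_cmult_right dconvD dconv_dtau s)
      then show ?thesis
        by (simp add: pow s dterm_def[abs_def] algebra_simps)
    qed
    then have "f - dtau z = 0"
      by (intro dser_eq_0I) (auto simp: dconv_def deval_def summable_on_def infsumI)
    then show "a = coeff (dtau z)"
      using f by simp
  qed simp
qed

section \<open>Truncation and the binomial series\<close>

lemma length_prod_list_subset:
  fixes n :: nat
  assumes "n > 0"
  shows "{ns. length ns = k \<and> prod_list ns dvd n} \<subseteq> {ns. set ns \<subseteq> {..n} \<and> length ns = k}"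
proof (rule subsetI)
  fix ns :: "nat list" assume ns: "ns \<in> {ns. length ns = k \<and> prod_list ns dvd n}"
  have "m \<le> n" if "m \<in> set ns" for m
  proof (rule dvd_imp_le)
    have "m dvd prod_list ns"
      using that by (rule prod_list_dvd)
    also have "prod_list ns dvd n"
      using ns by simp
    finally show "m dvd n" .
  qed (rule assms)
  then show "ns \<in> {ns. set ns \<subseteq> {..n} \<and> length ns = k}"
    using ns by auto
qed

lemma finite_prod_list_dvd:
  fixes n :: nat
  assumes "n > 0"
  shows "finite {ns. length ns = k \<and> prod_list ns dvd n}"
  by (rule finite_subset[OF length_prod_list_subset[OF assms] finite_lists_length_eq]) simp

lemma finite_prod_lists:
  fixes n :: nat
  assumes "n > 0"
  shows "finite {ns. length ns = k \<and> prod_list ns = n}"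
  by (rule finite_subset[OF _ finite_prod_list_dvd[OF assms, of k]]) auto

text \<open>Induction on \<open>k\<close>, splitting off the first entry of the list.\<close>

lemma coeff_power:
  assumes "n > 0"
  shows "coeff (f ^ k) n = (\<Sum>ns | length ns = k \<and> prod_list ns = n. \<Prod>m\<leftarrow>ns. coeff f m)"
  using assms
proof (induction k arbitrary: n)
  case 0
  have "{ns. length ns = 0 \<and> prod_list ns = n} = (if n = 1 then {[]} else {})"
    by auto
  then show ?case
    by (simp add: coeff_one)
next
  case (Suc k)
  let ?L = "\<lambda>m. {ns. length ns = k \<and> prod_list ns = m}"
  have fin: "finite (?L (snd p))" if "fst p * snd p = n" for p
    using that Suc.prems by (intro finite_prod_lists) (auto intro: Nat.gr0I)
  have "coeff (f ^ Suc k) n = (\<Sum>p | fst p * snd p = n. coeff f (fst p) * coeff (f ^ k) (snd p))"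
    by (simp add: coeff_mult case_prod_unfold)
  also have "\<dots> = (\<Sum>p | fst p * snd p = n. \<Sum>ns\<in>?L (snd p). coeff f (fst p) * (\<Prod>m\<leftarrow>ns. coeff f m))"
    using Suc.prems
    by (intro sum.cong refl, subst Suc.IH) (auto simp: sum_distrib_left intro: Nat.gr0I)
  also have "\<dots> = (\<Sum>(p, ns)\<in>Sigma {p. fst p * snd p = n} (\<lambda>p. ?L (snd p)).
      coeff f (fst p) * (\<Prod>m\<leftarrow>ns. coeff f m))"
    using fin finite_mult_pairs[OF Suc.prems] by (subst sum.Sigma) (auto simp: case_prod_unfold)
  also have "\<dots> = (\<Sum>ns | length ns = Suc k \<and> prod_list ns = n. \<Prod>m\<leftarrow>ns. coeff f m)"
    by (rule sum.reindex_bij_witness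
          [of _ "\<lambda>ns. ((hd ns, prod_list (tl ns)), tl ns)" "\<lambda>(p, ns). fst p # ns"])
       (auto simp: length_Suc_conv)
  finally show ?case .
qed

lemma coeff_power_mult_power:
  assumes "n > 0"
  shows "coeff (f ^ a * g ^ b) n =
    (\<Sum>(ms, ns) | length ms = a \<and> length ns = b \<and> prod_list ms * prod_list ns = n.
       (\<Prod>m\<leftarrow>ms. coeff f m) * (\<Prod>m\<leftarrow>ns. coeff g m))"
proof -
  let ?L = "\<lambda>k m. {ns. length ns = k \<and> prod_list ns = (m::nat)}"
  have pos: "fst p > 0" "snd p > 0" if "fst p * snd p = n" for p
    using that assms by (auto intro: Nat.gr0I)
  have "coeff (f ^ a * g ^ b) n = (\<Sum>p | fst p * snd p = n. coeff (f ^ a) (fst p) * coeff (g ^ b) (snd p))"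
    by (simp add: coeff_mult case_prod_unfold)
  also have "\<dots> = (\<Sum>p | fst p * snd p = n. \<Sum>(ms, ns)\<in>?L a (fst p) \<times> ?L b (snd p).
      (\<Prod>m\<leftarrow>ms. coeff f m) * (\<Prod>m\<leftarrow>ns. coeff g m))"
    using pos by (intro sum.cong refl) (simp add: coeff_power sum_product sum.cartesian_product)
  also have "\<dots> = (\<Sum>(p, q)\<in>Sigma {p. fst p * snd p = n} (\<lambda>p. ?L a (fst p) \<times> ?L b (snd p)).
      (\<Prod>m\<leftarrow>fst q. coeff f m) * (\<Prod>m\<leftarrow>snd q. coeff g m))"
    using pos finite_prod_lists finite_mult_pairs[OF assms]
    by (subst sum.Sigma) (auto simp: case_prod_unfold)
  also have "\<dots> = (\<Sum>(ms, ns) | length ms = a \<and> length ns = b \<and> prod_list ms * prod_list ns = n.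
       (\<Prod>m\<leftarrow>ms. coeff f m) * (\<Prod>m\<leftarrow>ns. coeff g m))"
    by (rule sum.reindex_bij_witness
          [of _ "\<lambda>q. ((prod_list (fst q), prod_list (snd q)), q)" snd]) auto
  finally show ?thesis .
qed

lift_definition dtrunc :: "real \<Rightarrow> dser \<Rightarrow> dser" is "\<lambda>y f n. if real n \<le> y then f n else 0"
  by simp

lemma coeff_dtrunc: "coeff (dtrunc y f) n = (if real n \<le> y then coeff f n else 0)"
  by transfer simp

text \<open>This turns the inner sums of the theorem into coefficients of ring elements: each
  \<open>m\<close> contributes a factor 1 from \<open>dzeta\<close>, and the truncation kills every
  tuple with an entry of \<open>ns\<close> above \<open>y\<close>.\<close>

lemma sum_factor_tuples:
  assumes "n > 0"
  shows "(\<Sum>(ms, ns)\<in>factor_tuples a b y n. \<Prod>k\<leftarrow>ns. coeff f k) = coeff (dzeta ^ a * dtrunc y f ^ b) n"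
proof -
  let ?T = "{(ms, ns). length ms = a \<and> length ns = b \<and> prod_list ms * prod_list ns = n}"
  \<comment> \<open>A zero entry would make the whole product 0, so \<open>?T\<close> and
    \<open>factor_tuples\<close> differ only by the size condition on \<open>ns\<close>.\<close>
  have pos: "m > 0" if "(ms, ns) \<in> ?T" "m \<in> set ms \<union> set ns" for m ms ns
  proof (rule Nat.gr0I)
    assume "m = 0"
    then have "prod_list ms = 0 \<or> prod_list ns = 0"
      using that(2) by (auto simp: prod_list_zero_iff)
    then show False
      using that(1) assms by auto
  qed
  have fin: "finite ?T"
    by (rule finite_subset[OF _ finite_cartesian_product
          [OF finite_prod_list_dvd[OF assms, of a] finite_prod_list_dvd[OF assms, of b]]]) auto
  have one: "(\<Prod>m\<leftarrow>ms. coeff dzeta m) = 1" if "\<forall>m\<in>set ms. m > 0" for ms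
    using that by (induction ms) (auto simp: coeff_dzeta)
  have trunc: "(\<Prod>m\<leftarrow>ns. coeff (dtrunc y f) m) =
      (if \<forall>m\<in>set ns. real m \<le> y then \<Prod>m\<leftarrow>ns. coeff f m else 0)" for ns
    by (induction ns) (auto simp: coeff_dtrunc)
  have "coeff (dzeta ^ a * dtrunc y f ^ b) n =
      (\<Sum>(ms, ns)\<in>?T. if \<forall>m\<in>set ns. real m \<le> y then \<Prod>m\<leftarrow>ns. coeff f m else 0)"
    unfolding coeff_power_mult_power[OF assms] trunc using pos
    by (intro sum.cong refl) (auto simp: one)
  also have "\<dots> = (\<Sum>(ms, ns)\<in>factor_tuples a b y n. \<Prod>m\<leftarrow>ns. coeff f m)"
  proof (rule sum.mono_neutral_cong_right[OF fin])
    show "factor_tuples a b y n \<subseteq> ?T"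
      by (auto simp: factor_tuples_def)
    show "\<forall>p\<in>?T - factor_tuples a b y n.
        (case p of (ms, ns) \<Rightarrow> if \<forall>m\<in>set ns. real m \<le> y then \<Prod>m\<leftarrow>ns. coeff f m else 0) = 0"
    proof
      fix p assume p: "p \<in> ?T - factor_tuples a b y n"
      obtain ms ns where [simp]: "p = (ms, ns)"
        by (cases p)
      have "\<not> (\<forall>m\<in>set ns. real m \<le> y)"
        using p pos[of ms ns] by (auto simp: factor_tuples_def)
      then show "(case p of (ms, ns) \<Rightarrow> if \<forall>m\<in>set ns. real m \<le> y then \<Prod>m\<leftarrow>ns. coeff f m else 0) = 0"
        by auto
    qed
  qed (auto simp: factor_tuples_def)
  finally show ?thesis ..
qed

section \<open>Vanishing up to a threshold\<close>

definition vanishes_upto :: "real \<Rightarrow> dser \<Rightarrow> bool" where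
  "vanishes_upto x f \<longleftrightarrow> (\<forall>n. real n \<le> x \<longrightarrow> coeff f n = 0)"

text \<open>If \<open>a * b \<le> x * y\<close>, then \<open>a \<le> x\<close> or
  \<open>b \<le> y\<close>; thus thresholds multiply.\<close>

lemma vanishes_upto_mult:
  assumes "vanishes_upto x f" "vanishes_upto y g" "x \<ge> 0" "y \<ge> 0"
  shows "vanishes_upto (x * y) (f * g)"
  unfolding vanishes_upto_def
proof (intro allI impI)
  fix n :: nat assume n: "real n \<le> x * y"
  have "coeff f a * coeff g b = 0" if "a * b = n" for a b
  proof (cases "real a \<le> x \<or> real b \<le> y")
    case False
    then have "x * y < real a * real b"
      using assms by (intro mult_strict_mono) auto
    then show ?thesis
      using n that by auto
  qed (use assms in \<open>auto simp: vanishes_upto_def\<close>)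
  then show "coeff (f * g) n = 0"
    unfolding coeff_mult by (intro sum.neutral) auto
qed

lemma vanishes_upto_mult_right:
  assumes "vanishes_upto x f"
  shows "vanishes_upto x (g * f)"
  unfolding vanishes_upto_def
proof (intro allI impI)
  fix n :: nat assume n: "real n \<le> x"
  have "coeff g a * coeff f b = 0" if "a * b = n" for a b
  proof (cases "a = 0")
    case False
    then have "b \<le> n"
      using that by auto
    then show ?thesis
      using assms n by (auto simp: vanishes_upto_def)
  qed simp
  then show "coeff (g * f) n = 0"
    unfolding coeff_mult by (intro sum.neutral) auto
qed

lemma vanishes_upto_dderiv: "vanishes_upto x f \<Longrightarrow> vanishes_upto x (dderiv f)"
  by (simp add: vanishes_upto_def coeff_dderiv)

lemma vanishes_upto_power_mult:
  assumes "vanishes_upto y f" "vanishes_upto y g" "y \<ge> 0"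
  shows "vanishes_upto (y ^ Suc k) (f ^ k * g)"
proof (induction k)
  case (Suc k)
  have "vanishes_upto (y * y ^ Suc k) (f * (f ^ k * g))"
    using assms Suc.IH by (intro vanishes_upto_mult) auto
  then show ?case
    by (simp add: mult.assoc)
qed (use assms in simp)

section \<open>The truncated binomial series\<close>

text \<open>The coefficients of the power series of \<open>(1 - X) powr (- \<beta>)\<close>.\<close>

definition neg_binom :: "'a::field_char_0 \<Rightarrow> nat \<Rightarrow> 'a" where
  "neg_binom \<beta> j = pochhammer \<beta> j / fact j"

lemma neg_binom_Suc: "of_nat (Suc j) * neg_binom \<beta> (Suc j) = (\<beta> + of_nat j) * neg_binom \<beta> j"
  unfolding neg_binom_def pochhammer_Suc fact_Suc of_nat_mult
  by (simp add: field_simps del: of_nat_Suc)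

text \<open>The truncation at degree \<open>K\<close> of the equation \<open>(1 - X) F' = \<beta> F\<close> for \<open>F = (1 - X) powr (- \<beta>)\<close>.\<close>

lemma neg_binom_ode:
  "(1 - M) * (\<Sum>j<K. dconst (neg_binom \<beta> j) * (of_nat j * M ^ (j - 1))) =
   dconst \<beta> * (\<Sum>j<K. dconst (neg_binom \<beta> j) * M ^ j) -
   of_nat K * dconst (neg_binom \<beta> K) * M ^ (K - 1)"
proof (induction K)
  case (Suc K)
  define S where "S = (\<Sum>j<K. dconst (neg_binom \<beta> j) * M ^ j)"
  define S' where "S' = (\<Sum>j<K. dconst (neg_binom \<beta> j) * (of_nat j * M ^ (j - 1)))"
  define a where "a = dconst (neg_binom \<beta> K)"
  have step: "of_nat (Suc K) * dconst (neg_binom \<beta> (Suc K)) = (dconst \<beta> + of_nat K) * a"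
    unfolding a_def
    by (simp only: neg_binom_Suc dconst_of_nat[symmetric] dconst_mult[symmetric] dconst_add[symmetric])
  have MK: "M * (of_nat K * M ^ (K - 1)) = of_nat K * M ^ K"
    by (cases K) (simp_all add: algebra_simps)
  have IH: "(1 - M) * S' = dconst \<beta> * S - of_nat K * a * M ^ (K - 1)"
    using Suc.IH by (simp only: S_def S'_def a_def)
  have "(1 - M) * (S' + a * (of_nat K * M ^ (K - 1))) =
      (1 - M) * S' + a * (of_nat K * M ^ (K - 1)) - a * (M * (of_nat K * M ^ (K - 1)))"
    by (simp add: algebra_simps)
  also have "\<dots> = dconst \<beta> * (S + a * M ^ K) - (dconst \<beta> + of_nat K) * a * M ^ K"
    unfolding MK IH by (simp add: algebra_simps)
  finally show ?case
    unfolding sum.lessThan_Suc step[symmetric] by (simp add: S_def S'_def a_def)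
qed simp

text \<open>With \<open>M = 1 - Q ^ v\<close>, the sum is the truncated series of
  \<open>(1 - M)\<close> to the power \<open>- w / v\<close>, formally the inverse of
  \<open>Q ^ w\<close>. The derivative of the product is a multiple of
  \<open>M ^ (K - 1) * dderiv Q\<close>, hence vanishes up to \<open>y ^ K\<close>, and its
  coefficient at 1 is 1.\<close>

lemma unipotent_power_neg_binom:
  assumes "vanishes_upto y (Q - 1)" "y \<ge> 1" "v > 0" "w > 0" "K > 0"
  shows "vanishes_upto (y ^ K) (Q ^ w * (\<Sum>j<K. dconst (neg_binom (of_nat w / of_nat v) j) * (1 - Q ^ v) ^ j) - 1)"
proof -
  define \<beta> :: complex where "\<beta> = of_nat w / of_nat v"
  define M where "M = 1 - Q ^ v"
  define S where "S = (\<Sum>j<K. dconst (neg_binom \<beta> j) * M ^ j)"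
  define S' where "S' = (\<Sum>j<K. dconst (neg_binom \<beta> j) * (of_nat j * M ^ (j - 1)))"
  have Q: "vanishes_upto y (dderiv Q)"
    using vanishes_upto_dderiv[OF assms(1)] by (simp add: dderiv_diff)
  \<comment> \<open>\<open>Q ^ v - 1\<close> is divisible by \<open>Q - 1\<close>, so
    \<open>M\<close> inherits the vanishing up to \<open>y\<close>.\<close>
  have "M = - (\<Sum>i<v. Q ^ i) * (Q - 1)"
    unfolding M_def by (simp add: one_diff_power_eq algebra_simps)
  then have M: "vanishes_upto y M"
    using vanishes_upto_mult_right[OF assms(1)] by (simp only:)
  \<comment> \<open>The \<open>K - 1\<close> factors \<open>M\<close> and the single factor
    \<open>dderiv Q\<close> together give the threshold \<open>y ^ K\<close>.\<close>
  have MQ: "vanishes_upto (y ^ K) (M ^ (K - 1) * dderiv Q)"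
    using vanishes_upto_power_mult[OF M Q, of "K - 1"] assms by simp
  have "dderiv M = - (of_nat v * Q ^ (v - 1) * dderiv Q)"
    by (simp add: M_def dderiv_diff dderiv_power)
  then have dS: "dderiv S = S' * - (of_nat v * Q ^ (v - 1) * dderiv Q)"
    by (simp add: S_def S'_def dderiv_sum dderiv_dconst_mult dderiv_power sum_distrib_right mult.assoc
        del: mult_minus_right)
  have Qw: "Q ^ w = Q ^ (w - 1) * Q"
    using power_minus_mult[OF assms(4), of Q] by (rule sym)
  have Qv: "Q * Q ^ (v - 1) = 1 - M"
    unfolding M_def using power_minus_mult[OF assms(3), of Q] by (simp add: mult.commute)
  have ode: "(1 - M) * S' = dconst \<beta> * S - of_nat K * dconst (neg_binom \<beta> K) * M ^ (K - 1)"
    unfolding S_def S'_def by (rule neg_binom_ode)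
  have \<beta>: "of_nat w = of_nat v * dconst \<beta>"
    using assms by (simp add: \<beta>_def dconst_of_nat[symmetric] dconst_mult[symmetric])
  have "dderiv (Q ^ w * S) =
      of_nat w * Q ^ (w - 1) * dderiv Q * S + Q ^ w * (S' * - (of_nat v * Q ^ (v - 1) * dderiv Q))"
    by (simp only: dderiv_mult dderiv_power dS)
  also have "\<dots> = Q ^ (w - 1) * dderiv Q * (of_nat w * S - of_nat v * ((Q * Q ^ (v - 1)) * S'))"
  proof -
    have "a * b * c * S + (b * d) * (S' * - (e * f * c)) = b * c * (a * S - e * ((d * f) * S'))"
      for a b c d e f S S' :: dser
      by (simp add: algebra_simps)
    then show ?thesis
      unfolding Qw .
  qed
  \<comment> \<open>Since \<open>Q * Q ^ (v - 1) = 1 - M\<close> and \<open>w = v\<close> \<beta>,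
    the truncated differential equation cancels everything except its top term.\<close>
  also have "\<dots> = of_nat v * of_nat K * dconst (neg_binom \<beta> K) * Q ^ (w - 1) * (M ^ (K - 1) * dderiv Q)"
  proof -
    have "b * c * (e * d * S - e * (d * S - k * a * m)) = e * k * a * b * (m * c)"
      for a b c d e k m S :: dser
      by (simp add: algebra_simps)
    then show ?thesis
      unfolding Qv ode \<beta> .
  qed
  finally have "dderiv (Q ^ w * S) =
      of_nat v * of_nat K * dconst (neg_binom \<beta> K) * Q ^ (w - 1) * (M ^ (K - 1) * dderiv Q)" .
  then have deriv: "vanishes_upto (y ^ K) (dderiv (Q ^ w * S))"
    using vanishes_upto_mult_right[OF MQ] by simp
  have one: "coeff (Q ^ w * S) 1 = 1"
  proof -
    have "coeff (Q - 1) 1 = 0" "coeff M 1 = 0"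
      using assms(1,2) M unfolding vanishes_upto_def by auto
    moreover have "coeff S 1 = (\<Sum>j<K. neg_binom \<beta> j * coeff M 1 ^ j)"
      by (simp only: S_def coeff_sum coeff_dconst_mult coeff_power_1)
    moreover have "(\<Sum>j<K. neg_binom \<beta> j * 0 ^ j) = (\<Sum>j<K. if j = 0 then 1 else 0)"
      by (intro sum.cong) (auto simp: neg_binom_def)
    ultimately show ?thesis
      using assms by (simp add: coeff_mult_1[simplified] coeff_power_1[simplified] coeff_one)
  qed
  have "coeff (Q ^ w * S) n = coeff 1 n" if "real n \<le> y ^ K" for n
    by (rule dser_eqI_dderiv[OF _ _ that])
       (use deriv one in \<open>auto simp: vanishes_upto_def coeff_one\<close>)
  then show ?thesis
    unfolding vanishes_upto_def S_def \<beta>_def M_def by simp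
qed

section \<open>Rationality and size of the coefficients\<close>

text \<open>The coefficient of \<open>P ^ i\<close> once the truncated series in
  \<open>1 - P\<close> is expanded in powers of \<open>P\<close>; it is kept in the rationals until
  it is embedded in the complex numbers.\<close>

definition trunc_coeff :: "nat \<Rightarrow> rat \<Rightarrow> nat \<Rightarrow> rat" where
  "trunc_coeff K \<beta> i = (\<Sum>j<K. neg_binom \<beta> j * of_nat (j choose i) * (- 1) ^ i)"

lemma of_rat_neg_binom: "(of_rat (neg_binom \<beta> j) :: 'a::field_char_0) = neg_binom (of_rat \<beta>) j"
proof -
  have "(of_rat (pochhammer \<beta> j) :: 'a) = pochhammer (of_rat \<beta>) j"
    by (induction j) (simp_all add: pochhammer_Suc of_rat_mult of_rat_add)
  moreover have "(of_rat (fact j) :: 'a) = fact j"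
    by (metis of_nat_fact of_rat_of_nat_eq)
  ultimately show ?thesis
    by (simp add: neg_binom_def of_rat_divide)
qed

lemma dconst_sum: "dconst (\<Sum>i\<in>A. F i) = (\<Sum>i\<in>A. dconst (F i))"
proof -
  have "dconst 0 = 0"
    by transfer auto
  then show ?thesis
    by (induction A rule: infinite_finite_induct) (auto simp: dconst_add)
qed

lemma trunc_coeff_expand:
  "(\<Sum>j<K. dconst (neg_binom (of_rat \<beta>) j) * (1 - P) ^ j) =
   (\<Sum>i<K. dconst (of_rat (trunc_coeff K \<beta> i)) * P ^ i)"
proof -
  have "(1 - P) ^ j = (\<Sum>i<K. dconst (of_nat (j choose i) * (- 1) ^ i) * P ^ i)" if "j < K" for j
  proof -
    have "dconst (- 1) = - 1"
      by transfer auto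
    then have pow: "dconst ((- 1) ^ i) = (- 1) ^ i" for i
      by (induction i) (simp_all only: power_Suc dconst_mult power_0 dconst_1)
    have "(1 - P) ^ j = (- P + 1) ^ j"
      by simp
    also have "\<dots> = (\<Sum>i\<le>j. of_nat (j choose i) * (- P) ^ i)"
      by (subst binomial_ring) simp
    \<comment> \<open>The binomial coefficients vanish for \<open>i > j\<close>; a common range
      \<open>i < K\<close> allows the order of summation to be exchanged.\<close>
    also have "\<dots> = (\<Sum>i<K. of_nat (j choose i) * (- P) ^ i)"
      using that by (intro sum.mono_neutral_left) (auto simp: binomial_eq_0)
    also have "\<dots> = (\<Sum>i<K. dconst (of_nat (j choose i) * (- 1) ^ i) * P ^ i)"
      by (intro sum.cong refl) (simp add: dconst_mult dconst_of_nat pow power_minus[of P] mult.assoc)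
    finally show ?thesis .
  qed
  then have "(\<Sum>j<K. dconst (neg_binom (of_rat \<beta>) j) * (1 - P) ^ j) =
      (\<Sum>j<K. \<Sum>i<K. dconst (neg_binom (of_rat \<beta>) j) * (dconst (of_nat (j choose i) * (- 1) ^ i) * P ^ i))"
    by (simp add: sum_distrib_left)
  also have "\<dots> = (\<Sum>i<K. \<Sum>j<K. dconst (neg_binom (of_rat \<beta>) j) * (dconst (of_nat (j choose i) * (- 1) ^ i) * P ^ i))"
    by (rule sum.swap)
  also have "\<dots> = (\<Sum>i<K. dconst (of_rat (trunc_coeff K \<beta> i)) * P ^ i)"
    by (simp add: trunc_coeff_def of_rat_sum of_rat_mult of_rat_power of_rat_neg_binom dconst_sum
        sum_distrib_right dconst_mult mult.assoc)
  finally show ?thesis .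
qed

text \<open>Obtained by replacing \<beta> by the upper bound \<open>r\<close> and each binomial
  coefficient by \<open>2 ^ j\<close>, so that no dependence on \<open>u\<close>, \<open>v\<close>
  or \<open>i\<close> remains.\<close>

definition trunc_bound :: "nat \<Rightarrow> nat \<Rightarrow> real" where
  "trunc_bound K r = (\<Sum>j<K. neg_binom (of_nat r) j * 2 ^ j)"

lemma neg_binom_mono:
  fixes a b :: "'a::linordered_field"
  assumes "0 \<le> a" "a \<le> b"
  shows "0 \<le> neg_binom a j" "neg_binom a j \<le> neg_binom b j"
proof -
  have "0 \<le> pochhammer a j \<and> pochhammer a j \<le> pochhammer b j"
    using assms by (induction j) (auto simp: pochhammer_Suc intro!: mult_mono)
  then show "0 \<le> neg_binom a j" "neg_binom a j \<le> neg_binom b j"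
    by (auto simp: neg_binom_def divide_right_mono)
qed

lemma abs_trunc_coeff_le:
  assumes "0 \<le> \<beta>" "\<beta> \<le> of_nat r"
  shows "\<bar>of_rat (trunc_coeff K \<beta> i) :: real\<bar> \<le> trunc_bound K r"
proof -
  have \<beta>: "0 \<le> (of_rat \<beta> :: real)" "of_rat \<beta> \<le> real r"
    using assms by (simp, metis of_rat_less_eq of_rat_of_nat_eq)
  have "\<bar>of_rat (trunc_coeff K \<beta> i) :: real\<bar> =
      \<bar>\<Sum>j<K. neg_binom (of_rat \<beta>) j * real (j choose i) * (- 1) ^ i\<bar>"
    by (simp add: trunc_coeff_def of_rat_sum of_rat_mult of_rat_power of_rat_neg_binom)
  also have "\<dots> \<le> (\<Sum>j<K. \<bar>neg_binom (of_rat \<beta>) j * real (j choose i) * (- 1) ^ i\<bar>)"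
    by (rule sum_abs)
  also have "\<dots> \<le> trunc_bound K r"
    unfolding trunc_bound_def
  proof (rule sum_mono)
    fix j
    have "real (j choose i) \<le> real (2 ^ j)"
      by (intro of_nat_mono binomial_le_pow2)
    then have "neg_binom (of_rat \<beta>) j * real (j choose i) \<le> neg_binom (real r) j * 2 ^ j"
      using neg_binom_mono[OF \<beta>] neg_binom_mono(1)[of "real r" "real r"] by (intro mult_mono) auto
    then show "\<bar>neg_binom (of_rat \<beta>) j * real (j choose i) * (- 1) ^ i\<bar> \<le> neg_binom (real r) j * 2 ^ j"
      using neg_binom_mono(1)[OF \<beta>] by (simp add: abs_mult power_abs)
  qed
  finally show ?thesis .
qed

section \<open>Both identities from one decomposition\<close>

text \<open>The parameters \<open>m\<close> and \<open>R\<close> cover both identities: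
  \<open>R = 1\<close>, \<open>m = r + 1\<close> gives the first and \<open>R = r\<close>,
  \<open>m = 0\<close> the second.\<close>

lemma dtau_decomposition:
  fixes u v R K m n :: nat and z :: complex
  assumes K: "K \<ge> 1" and u: "u < v" and R: "R \<ge> 1" and x: "x \<ge> 1"
    and z: "z = of_nat m - of_nat R + of_nat u / of_nat v" and n: "n \<ge> 1" "real n \<le> x"
  shows "coeff (dtau z) n = (\<Sum>i<K. of_rat (trunc_coeff K (of_nat R - of_nat u / of_nat v) i) *
    (\<Sum>(ms, ns)\<in>factor_tuples (i + m) (i * v + (R * v - u)) (x powr (1 / real K)) n.
       \<Prod>k\<leftarrow>ns. coeff (dtau (- 1 / of_nat v)) k))"
proof -
  define y where "y = x powr (1 / real K)"
  define w where "w = R * v - u"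
  define \<beta> :: rat where "\<beta> = of_nat R - of_nat u / of_nat v"
  define c where "c = trunc_coeff K \<beta>"
  define G where "G = dtrunc y (dtau (- 1 / of_nat v))"
  define Q where "Q = dtau (1 / of_nat v) * G"
  have "1 * v \<le> R * v"
    using R by (rule mult_le_mono1)
  then have uw: "u < R * v"
    using u by linarith
  then have w: "w > 0"
    by (simp add: w_def)
  have wv: "of_nat w / of_nat v = (of_nat R - of_nat u / of_nat v :: complex)"
    using uw u by (simp add: w_def of_nat_diff field_simps)
  then have \<beta>: "of_rat \<beta> = (of_nat w / of_nat v :: complex)"
    by (simp add: \<beta>_def of_rat_diff of_rat_divide)
  have y: "y \<ge> 1" "y ^ K = x"
    using x K by (simp_all add: y_def ge_one_powr_ge_zero powr_realpow[symmetric] powr_powr)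
  \<comment> \<open>The parameters \<open>1 / v\<close> and \<open>- 1 / v\<close> add up to 0, so
    the error of \<open>Q\<close> comes from the truncation alone.\<close>
  have "Q - 1 = dtau (1 / of_nat v) * (G - dtau (- 1 / of_nat v))"
    using dtau_add[of "1 / of_nat v" "- 1 / of_nat v"] by (simp add: Q_def algebra_simps dtau_zero)
  moreover have "vanishes_upto y (G - dtau (- 1 / of_nat v))"
    by (simp add: vanishes_upto_def G_def coeff_dtrunc)
  ultimately have "vanishes_upto y (Q - 1)"
    using vanishes_upto_mult_right by simp
  then have "vanishes_upto x (Q ^ w * (\<Sum>i<K. dconst (of_rat (c i)) * (Q ^ v) ^ i) - 1)"
    using unipotent_power_neg_binom[of y Q v w K] y u w K
    by (simp add: \<beta>[symmetric] trunc_coeff_expand c_def)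
  then have "vanishes_upto x (dtau z * (Q ^ w * (\<Sum>i<K. dconst (of_rat (c i)) * (Q ^ v) ^ i) - 1))"
    by (rule vanishes_upto_mult_right)
  then have "coeff (dtau z) n = coeff (dtau z * (Q ^ w * (\<Sum>i<K. dconst (of_rat (c i)) * (Q ^ v) ^ i))) n"
    using n by (simp add: vanishes_upto_def right_diff_distrib)
  also have "dtau z * (Q ^ w * (\<Sum>i<K. dconst (of_rat (c i)) * (Q ^ v) ^ i)) =
      (\<Sum>i<K. dconst (of_rat (c i)) * (dzeta ^ (i + m) * G ^ (i * v + w)))"
    unfolding sum_distrib_left
  proof (intro sum.cong refl)
    fix i
    have Qv: "Q ^ v = dzeta * G ^ v"
      using u dtau_mult_of_nat[of v "1 / of_nat v"] by (simp add: Q_def power_mult_distrib dtau_one)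
    have Qw: "Q ^ w = dtau (of_nat w / of_nat v) * G ^ w"
      using dtau_mult_of_nat[of w "1 / of_nat v"] by (simp add: Q_def power_mult_distrib)
    \<comment> \<open>As \<open>z + w / v = m\<close>, the fractional powers combine to an integral
      power of zeta.\<close>
    have "dtau z * dtau (of_nat w / of_nat v) = dzeta ^ m"
      by (simp add: dtau_add[symmetric] z wv dtau_of_nat)
    moreover have "G ^ (i * v + w) = (G ^ v) ^ i * G ^ w"
      by (simp add: power_add power_mult[symmetric] mult.commute)
    ultimately have "dconst (of_rat (c i)) * (dzeta ^ (i + m) * G ^ (i * v + w)) =
        dconst (of_rat (c i)) * (dzeta ^ i * (dtau z * dtau (of_nat w / of_nat v)) * ((G ^ v) ^ i * G ^ w))"
      by (simp only: power_add[of dzeta])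
    also have "\<dots> = dtau z * ((dtau (of_nat w / of_nat v) * G ^ w) * (dconst (of_rat (c i)) * (dzeta * G ^ v) ^ i))"
      by (simp only: power_mult_distrib mult_ac)
    finally show "dtau z * (Q ^ w * (dconst (of_rat (c i)) * (Q ^ v) ^ i)) =
        dconst (of_rat (c i)) * (dzeta ^ (i + m) * G ^ (i * v + w))"
      by (simp only: Qv Qw)
  qed
  also have "coeff \<dots> n = (\<Sum>i<K. of_rat (c i) * coeff (dzeta ^ (i + m) * G ^ (i * v + w)) n)"
    by (simp add: coeff_sum)
  finally show ?thesis
    using n sum_factor_tuples[of n, where y = y] by (simp add: G_def c_def \<beta>_def y_def w_def)
qed

theorem theorem3p2:
  fixes K r :: nat
  assumes "K \<ge> 1"
  shows "\<exists>C::real. \<forall>(u::nat) (v::nat) (x::real). u < v \<longrightarrow> x \<ge> 1 \<longrightarrow>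
    (\<exists>cp :: nat \<Rightarrow> rat.
       (\<forall>l\<in>{1..K}. \<bar>of_rat (cp l) :: real\<bar> \<le> C) \<and>
       (\<forall>n::nat. n \<ge> 1 \<longrightarrow> real n \<le> x \<longrightarrow>
          gen_divisor (of_nat r + of_nat u / of_nat v) n =
          (\<Sum>l=1..K. of_rat (cp l) *
             (\<Sum>(ms, ns)\<in>factor_tuples (l + r) (l * v - u) (x powr (1 / real K)) n.
                \<Prod>k\<leftarrow>ns. gen_divisor (- 1 / of_nat v) k)))) \<and>
    (r \<ge> 1 \<longrightarrow>
     (\<exists>cm :: nat \<Rightarrow> rat.
       (\<forall>l\<in>{1..K}. \<bar>of_rat (cm l) :: real\<bar> \<le> C) \<and>
       (\<forall>n::nat. n \<ge> 1 \<longrightarrow> real n \<le> x \<longrightarrow>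
          gen_divisor (- of_nat r + of_nat u / of_nat v) n =
          (\<Sum>l=1..K. of_rat (cm l) *
             (\<Sum>(ms, ns)\<in>factor_tuples (l - 1) (l * v + (r - 1) * v - u) (x powr (1 / real K)) n.
                \<Prod>k\<leftarrow>ns. gen_divisor (- 1 / of_nat v) k)))))"
proof (rule exI[of _ "trunc_bound K (Suc r)"], intro allI impI conjI)
  fix u v :: nat and x :: real
  assume u: "u < v" and x: "x \<ge> 1"
  \<comment> \<open>The shift \<open>l - 1\<close> passes from the range \<open>i < K\<close> to
    \<open>1 \<le> l \<le> K\<close>.\<close>
  define c where "c R l = trunc_coeff K (of_nat R - of_nat u / of_nat v) (l - 1)" for R l :: nat
  \<comment> \<open>Here \<open>R - u / v\<close> lies between 0 and \<open>R\<close>, and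
    \<open>R\<close> is 1 or \<open>r\<close>; the bound with \<open>Suc r\<close> serves both, also
    for \<open>r = 0\<close>.\<close>
  have bound: "\<bar>of_rat (c R l) :: real\<bar> \<le> trunc_bound K (Suc r)" if "1 \<le> R" "R \<le> Suc r" for R l
  proof -
    have "(0 :: rat) \<le> of_nat u / of_nat v" "(of_nat u / of_nat v :: rat) \<le> 1"
      using u by auto
    moreover have "(1 :: rat) \<le> of_nat R" "(of_nat R :: rat) \<le> of_nat (Suc r)"
      using that by (simp, simp only: of_nat_le_iff)
    ultimately show ?thesis
      unfolding c_def by (intro abs_trunc_coeff_le) linarith+
  qed
  have decomp: "gen_divisor z n = (\<Sum>l=1..K. of_rat (c R l) *
      (\<Sum>(ms, ns)\<in>factor_tuples (l - 1 + m) ((l - 1) * v + (R * v - u)) (x powr (1 / real K)) n.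
         \<Prod>k\<leftarrow>ns. gen_divisor (- 1 / of_nat v) k))"
    if "1 \<le> R" "z = of_nat m - of_nat R + of_nat u / of_nat v" "n \<ge> 1" "real n \<le> x" for z R m n
    using dtau_decomposition[OF assms u that(1) x that(2-4)]
    by (simp add: gen_divisor_eq c_def sum.atLeast1_atMost_eq)
  show "\<exists>cp :: nat \<Rightarrow> rat.
       (\<forall>l\<in>{1..K}. \<bar>of_rat (cp l) :: real\<bar> \<le> trunc_bound K (Suc r)) \<and>
       (\<forall>n::nat. n \<ge> 1 \<longrightarrow> real n \<le> x \<longrightarrow>
          gen_divisor (of_nat r + of_nat u / of_nat v) n =
          (\<Sum>l=1..K. of_rat (cp l) *
             (\<Sum>(ms, ns)\<in>factor_tuples (l + r) (l * v - u) (x powr (1 / real K)) n.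
                \<Prod>k\<leftarrow>ns. gen_divisor (- 1 / of_nat v) k)))"
  proof (intro exI[of _ "c 1"] conjI ballI allI impI)
    fix n :: nat assume n: "n \<ge> 1" "real n \<le> x"
    \<comment> \<open>As \<open>l \<ge> 1\<close> and \<open>u < v\<close>, all these natural
      subtractions are exact.\<close>
    have "l - 1 + Suc r = l + r \<and> (l - 1) * v + (1 * v - u) = l * v - u" if "l \<in> {1..K}" for l
      using that u by (cases l) auto
    then show "gen_divisor (of_nat r + of_nat u / of_nat v) n =
          (\<Sum>l=1..K. of_rat (c 1 l) *
             (\<Sum>(ms, ns)\<in>factor_tuples (l + r) (l * v - u) (x powr (1 / real K)) n.
                \<Prod>k\<leftarrow>ns. gen_divisor (- 1 / of_nat v) k))"
      by (subst decomp[of 1 _ "Suc r", OF _ _ n], simp_all only: cong: sum.cong) simp_all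
  qed (rule bound; simp)
  assume r: "r \<ge> 1"
  show "\<exists>cm :: nat \<Rightarrow> rat.
       (\<forall>l\<in>{1..K}. \<bar>of_rat (cm l) :: real\<bar> \<le> trunc_bound K (Suc r)) \<and>
       (\<forall>n::nat. n \<ge> 1 \<longrightarrow> real n \<le> x \<longrightarrow>
          gen_divisor (- of_nat r + of_nat u / of_nat v) n =
          (\<Sum>l=1..K. of_rat (cm l) *
             (\<Sum>(ms, ns)\<in>factor_tuples (l - 1) (l * v + (r - 1) * v - u) (x powr (1 / real K)) n.
                \<Prod>k\<leftarrow>ns. gen_divisor (- 1 / of_nat v) k)))"
  proof (intro exI[of _ "c r"] conjI ballI allI impI)
    fix n :: nat assume n: "n \<ge> 1" "real n \<le> x"
    have "(l - 1) * v + (r * v - u) = l * v + (r - 1) * v - u" if "l \<in> {1..K}" for l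
      using that u r by (cases l; cases r) auto
    then show "gen_divisor (- of_nat r + of_nat u / of_nat v) n =
          (\<Sum>l=1..K. of_rat (c r l) *
             (\<Sum>(ms, ns)\<in>factor_tuples (l - 1) (l * v + (r - 1) * v - u) (x powr (1 / real K)) n.
                \<Prod>k\<leftarrow>ns. gen_divisor (- 1 / of_nat v) k))"
      by (subst decomp[of r _ 0, OF r _ n], simp_all only: add_0_right cong: sum.cong) simp_all
  qed (rule bound; use r in simp)
qed

end
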